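(* For all $n,k\ge0$, $$N_q(n,k)=s_{\langle 2^k\rangle}(q,q^2,\dots,q^{n-1}).$$
   Context: A Dyck path of length $2n$ is a word $w=a_1\cdots a_{2n}$ in letters $v,h$ with $n$ of each such that every prefix has at least as many $v$'s as $h$'s; $\mathcal{D}_n$ is the set of these. $\mathrm{des}(w)$ is the number of indices $i$ with $a_ia_{i+1}=hv$ and $\mathrm{MAJ}(w)$ is the sum of these indices $i$. The $q$-Narayana numbers are $N_q(n,k)=\sum_{w\in\mathcal{D}_n,\ \mathrm{des}(w)=k}q^{\mathrm{MAJ}(w)}$. $\langle2^k\rangle$ is the partition $(2,\dots,2)$ with $k$ parts, and $s_\lambda$ is the Schur function, $s_\lambda(x)=\sum_T x^T$ over semistandard Young tableaux $T$ of shape $\lambda$, where $x^T=\prod_i x_i^{\#\{\text{entries of }T\text{ equal to } i\}}$. *)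

theory Defs
  imports Main
begin

datatype letter = V | H

definition dyck_paths :: "nat \<Rightarrow> letter list set" where
  "dyck_paths n = {w. length w = 2 * n \<and> count_list w V = n \<and> count_list w H = n \<and>
     (\<forall>m \<le> length w. count_list (take m w) H \<le> count_list (take m w) V)}"

(* Positions in a word are counted from 1, so a_i is w ! (i - 1). *)
definition descents :: "letter list \<Rightarrow> nat set" where
  "descents w = {i. 1 \<le> i \<and> i < length w \<and> w ! (i - 1) = H \<and> w ! i = V}"

definition des :: "letter list \<Rightarrow> nat" where
  "des w = card (descents w)"

definition MAJ :: "letter list \<Rightarrow> nat" where
  "MAJ w = \<Sum>(descents w)"

(* q ranges over all elements of all commutative semirings; the indeterminate of a
   polynomial ring is a special case. *)
definition q_narayana :: "'a::comm_semiring_1 \<Rightarrow> nat \<Rightarrow> nat \<Rightarrow> 'a" where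
  "q_narayana q n k = (\<Sum>w | w \<in> dyck_paths n \<and> des w = k. q ^ MAJ w)"

(* A tableau is the list of its rows (English convention), a partition the list of its
   parts in weakly decreasing order. The shape is only meaningful for such lists.
   The entries are bounded by the number m of variables. *)
definition ssyt :: "nat list \<Rightarrow> nat \<Rightarrow> nat list list set" where
  "ssyt lam m = {T. map length T = lam \<and>
     (\<forall>r \<in> set T. sorted r \<and> set r \<subseteq> {1..m}) \<and>
     (\<forall>i j. Suc i < length T \<and> j < length (T ! Suc i) \<longrightarrow> T ! i ! j < T ! Suc i ! j)}"

(* s_lam(x_1, ..., x_m) for the list xs = [x_1, ..., x_m]; all further variables are 0,
   that is, only tableaux with entries in {1..m} contribute. *)
definition schur_function :: "nat list \<Rightarrow> 'a::comm_semiring_1 list \<Rightarrow> 'a" where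
  "schur_function lam xs =
     (\<Sum>T \<in> ssyt lam (length xs).
        \<Prod>i = 1..length xs. (xs ! (i - 1)) ^ count_list (concat T) i)"

lemma finite_descents: "finite (descents w)"
  by (simp add: descents_def)

lemma finite_dyck_paths: "finite (dyck_paths n)"
proof (rule finite_subset)
  have "x \<in> {V, H}" for x
    by (cases x) auto
  then show "dyck_paths n \<subseteq> {w. set w \<subseteq> {V, H} \<and> length w = 2 * n}"
    by (auto simp: dyck_paths_def)
  show "finite {w. set w \<subseteq> {V, H} \<and> length w = 2 * n}"
    by (rule finite_lists_length_eq) simp
qed

lemma finite_ssyt: "finite (ssyt lam m)"
proof (rule finite_subset)
  let ?R = "\<Union>l \<in> set lam. {r. set r \<subseteq> {1..m} \<and> length r = l}"
  show "ssyt lam m \<subseteq> {T. set T \<subseteq> ?R \<and> length T = length lam}"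
    unfolding ssyt_def by fastforce
  have "finite ?R"
    by (intro finite_UN_I finite_set finite_lists_length_eq) simp
  then show "finite {T. set T \<subseteq> ?R \<and> length T = length lam}"
    by (rule finite_lists_length_eq)
qed

end

theory Submission
  imports Defs
begin

text \<open>
  A Dyck path is determined by its valleys, the points where a step \<open>h\<close> is followed by a step
  \<open>v\<close>. If \<open>b\<^sub>j\<close> and \<open>a\<^sub>j\<close> count the letters \<open>h\<close> and \<open>v\<close> before the \<open>j\<close>-th valley, then both
  sequences increase strictly and the path stays above the diagonal exactly if
  \<open>b\<^sub>j \<le> a\<^sub>j\<close> for all \<open>j\<close>. So the rows \<open>(b\<^sub>j, a\<^sub>j)\<close> form a semistandard tableau of shape
  \<open>\<langle>2\<^sup>k\<rangle>\<close>, and the \<open>j\<close>-th descent is at position \<open>b\<^sub>j + a\<^sub>j\<close>, the sum of the \<open>j\<close>-th row.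
\<close>

section \<open>Words and their valleys\<close>

fun valleys :: "nat \<Rightarrow> nat \<Rightarrow> letter list \<Rightarrow> (nat \<times> nat) list" where
  "valleys b a [] = []"
| "valleys b a (V # w) = valleys b (Suc a) w"
| "valleys b a (H # w) =
     (if w \<noteq> [] \<and> hd w = V then [(Suc b, a)] else []) @ valleys (Suc b) a w"

text \<open>The intended inverse of \<open>valleys\<close>: between consecutive valleys a word is a
  run of \<open>V\<close> followed by a run of \<open>H\<close>. As in \<open>valleys\<close>,
  \<open>b\<close> and \<open>a\<close> count the letters \<open>H\<close> and \<open>V\<close>
  already passed; \<open>m\<close> and \<open>n\<close> are the totals to be reached.\<close>

fun valley_path :: "nat \<Rightarrow> nat \<Rightarrow> nat \<Rightarrow> nat \<Rightarrow> (nat \<times> nat) list \<Rightarrow> letter list" where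
  "valley_path m n b a [] = replicate (n - a) V @ replicate (m - b) H"
| "valley_path m n b a ((b', a') # T) =
     replicate (a' - a) V @ replicate (b' - b) H @ valley_path m n b' a' T"

text \<open>Both strict bounds come from the letters at the valley: its \<open>H\<close> is already
  counted in \<open>b'\<close>, its \<open>V\<close> not yet in \<open>a'\<close>.\<close>

lemma set_valleys: "(b', a') \<in> set (valleys b a w) \<Longrightarrow>
    b < b' \<and> a \<le> a' \<and> b' \<le> b + count_list w H \<and> a' < a + count_list w V"
proof (induction w arbitrary: b a)
  case (Cons x w)
  have "0 < count_list w V" if "w \<noteq> []" "hd w = V"
    using that by (cases w) auto
  then show ?case
    using Cons.IH[of b "Suc a"] Cons.IH[of "Suc b" a] Cons.prems
    by (cases x) (auto split: if_splits)
qed simp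

lemma sorted_valleys:
  "sorted_wrt (\<lambda>p p'. fst p < fst p' \<and> snd p < snd p') (valleys b a w)"
proof (induction w arbitrary: b a)
  case (Cons x w)
  show ?case
  proof (cases x)
    case H
    have "Suc b < b' \<and> a < a'" if w: "w \<noteq> []" "hd w = V" "(b', a') \<in> set (valleys (Suc b) a w)"
      for b' a'
    proof -
      obtain u where "w = V # u"
        using w by (cases w) auto
      then show ?thesis
        using w set_valleys[of b' a' "Suc b" "Suc a" u] by simp
    qed
    then show ?thesis
      using H Cons.IH by (auto simp: sorted_wrt_append)
  qed (use Cons.IH in simp)
qed simp

text \<open>The run of \<open>H\<close> that starts here ends either with the word or in a valley,
  and the number of \<open>V\<close> does not change along it.\<close>

lemma valleys_H_cases:
  obtains "valleys b a (H # w) = []" "count_list w V = 0"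
  | b' T where "valleys b a (H # w) = (b', a) # T" "b < b'"
proof -
  have "valleys b a (H # w) = [] \<and> count_list w V = 0 \<or>
    (\<exists>b' T. valleys b a (H # w) = (b', a) # T \<and> b < b')"
  proof (induction w arbitrary: b)
    case (Cons x w)
    show ?case
    proof (cases x)
      case H
      then show ?thesis
        using Cons.IH[of "Suc b"] by (auto intro: Suc_lessD)
    qed simp
  qed simp
  then show thesis using that by blast
qed

lemma valley_path_valleys:
  assumes "b + count_list w H = m" "a + count_list w V = n"
  shows "valley_path m n b a (valleys b a w) = w"
  using assms
proof (induction w arbitrary: b a)
  case (Cons x w)
  show ?case
  proof (cases x)
    case V
    have IH: "valley_path m n b (Suc a) (valleys b (Suc a) w) = w"
      using V Cons by simp
    show ?thesis
    proof (cases "valleys b (Suc a) w")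
      case Nil
      have "n - a = Suc (n - Suc a)" using V Cons.prems by simp
      then show ?thesis using IH V Nil by simp
    next
      case (Cons p T)
      obtain b' a' where p: "p = (b', a')" by fastforce
      \<comment> \<open>The truncated difference is positive, so the first run of \<open>V\<close>
        loses exactly the letter \<open>x\<close>.\<close>
      have "Suc a \<le> a'"
        using set_valleys[of b' a' b "Suc a" w] Cons p by simp
      then have "a' - a = Suc (a' - Suc a)" by simp
      then show ?thesis
        using IH V p Cons by simp
    qed
  next
    case H
    have IH: "valley_path m n (Suc b) a (valleys (Suc b) a w) = w"
      using H Cons by simp
    show ?thesis
    proof (cases "w \<noteq> [] \<and> hd w = V")
      case True
      then show ?thesis using IH H by simp
    next
      case False
      show ?thesis
      proof (cases rule: valleys_H_cases[of b a w])
        case 1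
        then have "n = a" "m - b = Suc (m - Suc b)" using H Cons.prems by auto
        then show ?thesis using 1 False IH H by simp
      next
        case (2 b' T)
        \<comment> \<open>There is no valley right after \<open>x\<close>, so the run of
          \<open>H\<close> goes on and \<open>x\<close> can be split off from it.\<close>
        then have "Suc b < b'"
          using False set_valleys[of b' a "Suc b" a w] by simp
        then have "b' - b = Suc (b' - Suc b)" by simp
        then show ?thesis using 2 False IH H by simp
      qed
    qed
  qed
qed simp

lemma valleys_replicate_V: "valleys b a (replicate i V @ w) = valleys b (a + i) w"
  by (induction i arbitrary: a) auto

lemma valleys_replicate_H: "valleys b a (replicate i H) = []"
  by (induction i arbitrary: b) (auto simp: hd_replicate)

lemma valleys_replicate_H_V:
  "valleys b a (replicate (Suc i) H @ V # w) = (b + Suc i, a) # valleys (b + Suc i) a (V # w)"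
  by (induction i arbitrary: b) auto

text \<open>The bounds make every run of \<open>H\<close> before a listed valley, and the run of
  \<open>V\<close> after it, nonempty; so each such junction is a valley, and there are no
  others.\<close>

lemma valleys_valley_path:
  assumes "sorted_wrt (\<lambda>p p'. fst p < fst p' \<and> snd p < snd p') T"
    and "\<And>b' a'. (b', a') \<in> set T \<Longrightarrow> b < b' \<and> a \<le> a' \<and> a' < n"
  shows "valleys b a (valley_path m n b a T) = T"
  using assms
proof (induction T arbitrary: b a)
  case Nil
  show ?case by (simp add: valleys_replicate_V valleys_replicate_H)
next
  case (Cons p T)
  obtain b' a' where p: "p = (b', a')" by fastforce
  have bounds: "b < b'" "a \<le> a'" "a' < n"
    using Cons.prems(2)[of b' a'] p by auto
  have T: "b' < b'' \<and> a' < a'' \<and> a'' < n" if "(b'', a'') \<in> set T" for b'' a''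
    using that Cons.prems(1) Cons.prems(2)[of b'' a''] p by auto
  have IH: "valleys b' a' (valley_path m n b' a' T) = T"
    using Cons.IH[of b' a'] Cons.prems(1) T by (auto intro: less_imp_le)
  \<comment> \<open>The next run of \<open>V\<close> leads to a valley with larger second coordinate
    or, after the last valley, has length \<open>n - a' > 0\<close>.\<close>
  have "\<exists>u. valley_path m n b' a' T = V # u"
  proof (cases T)
    case Nil
    then show ?thesis using bounds by (cases "n - a'") auto
  next
    case (Cons p' T')
    then show ?thesis
      using T[of "fst p'" "snd p'"] by (cases p'; cases "snd p' - a'") auto
  qed
  then obtain u where u: "valley_path m n b' a' T = V # u" by blast
  obtain i where i: "b' = b + Suc i" using bounds less_imp_Suc_add by auto
  have "valleys b a (valley_path m n b a (p # T)) = valleys b a' (replicate (Suc i) H @ V # u)"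
    using p u i bounds by (simp add: valleys_replicate_V del: replicate.simps)
  also have "\<dots> = (b', a') # valleys b' a' (V # u)"
    unfolding valleys_replicate_H_V i by simp
  finally show ?case using IH u p by simp
qed

lemma count_list_replicate: "count_list (replicate i x) y = (if x = y then i else 0)"
  by (induction i) auto

text \<open>The run lengths telescope, and the bounds keep every subtraction from being
  truncated.\<close>

lemma count_valley_path:
  assumes "sorted_wrt (\<lambda>p p'. fst p < fst p' \<and> snd p < snd p') T"
    and "\<And>b' a'. (b', a') \<in> set T \<Longrightarrow> b \<le> b' \<and> b' \<le> m \<and> a \<le> a' \<and> a' \<le> n"
    and "b \<le> m" "a \<le> n"
  shows "b + count_list (valley_path m n b a T) H = m"
    and "a + count_list (valley_path m n b a T) V = n"
proof -
  have "b + count_list (valley_path m n b a T) H = m \<and>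
    a + count_list (valley_path m n b a T) V = n"
    using assms
  proof (induction T arbitrary: b a)
    case Nil
    then show ?case by (simp add: count_list_replicate)
  next
    case (Cons p T)
    obtain b' a' where p: "p = (b', a')" by fastforce
    have bounds: "b \<le> b'" "a \<le> a'" "a' \<le> n" "b' \<le> m"
      using Cons.prems(2)[of b' a'] p by auto
    have "b' \<le> b'' \<and> b'' \<le> m \<and> a' \<le> a'' \<and> a'' \<le> n" if "(b'', a'') \<in> set T" for b'' a''
      using that Cons.prems(1) Cons.prems(2)[of b'' a''] p by auto
    then show ?case
      using Cons.IH[of b' a'] Cons.prems(1) bounds p by (simp add: count_list_replicate)
  qed
  then show "b + count_list (valley_path m n b a T) H = m"
    and "a + count_list (valley_path m n b a T) V = n" by auto
qed

section \<open>The prefix condition at the valleys\<close>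

lemma all_prefixes_Cons:
  "(\<forall>i \<le> length (x # w). P (take i (x # w))) \<longleftrightarrow> P [] \<and> (\<forall>i \<le> length w. P (x # take i w))"
proof safe
  fix i
  assume "\<forall>i \<le> length (x # w). P (take i (x # w))" "i \<le> length w"
  then show "P (x # take i w)" by (metis Suc_le_mono length_Cons take_Suc_Cons)
next
  fix i
  assume "P []" "\<forall>i \<le> length w. P (x # take i w)" "i \<le> length (x # w)"
  then show "P (take i (x # w))" by (cases i) auto
qed (metis le0 take0)

text \<open>The excess of \<open>V\<close> over \<open>H\<close> is minimal at a valley or at an end
  of the word; the assumption takes care of the final end.\<close>

lemma above_diagonal_iff_valleys:
  assumes "b + count_list w H \<le> a + count_list w V"
  shows "(\<forall>i \<le> length w. b + count_list (take i w) H \<le> a + count_list (take i w) V) \<longleftrightarrow>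
    b \<le> a \<and> (\<forall>(b', a') \<in> set (valleys b a w). b' \<le> a')"
  using assms
proof (induction w arbitrary: b a)
  case (Cons x w)
  note split = all_prefixes_Cons[of x w "\<lambda>u. b + count_list u H \<le> a + count_list u V"]
  show ?case
  proof (cases x)
    case V
    then show ?thesis
      unfolding split using Cons.IH[of b "Suc a"] Cons.prems by auto
  next
    case H
    have "(\<forall>i \<le> length (x # w). b + count_list (take i (x # w)) H \<le> a + count_list (take i (x # w)) V)
      \<longleftrightarrow> b \<le> a \<and> Suc b \<le> a \<and> (\<forall>(b', a') \<in> set (valleys (Suc b) a w). b' \<le> a')"
      unfolding split using H Cons.IH[of "Suc b" a] Cons.prems by simp
    \<comment> \<open>\<open>Suc b \<le> a\<close> follows from the next valley
      \<open>(b', a)\<close>, where \<open>b < b'\<close>, or from the assumption if no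
      \<open>V\<close> is left.\<close>
    also have "\<dots> \<longleftrightarrow> b \<le> a \<and> (\<forall>(b', a') \<in> set (valleys b a (x # w)). b' \<le> a')"
      by (cases rule: valleys_H_cases[of b a w])
        (use H Cons.prems in \<open>auto split: if_splits\<close>)
    finally show ?thesis .
  qed
qed simp

section \<open>Descents and major index in terms of valleys\<close>

lemma descents_Cons:
  "descents (x # w) = (if x = H \<and> w \<noteq> [] \<and> hd w = V then {1} else {}) \<union> Suc ` descents w"
proof (rule set_eqI)
  fix i
  consider "i = 0" | "i = 1" | j where "i = Suc (Suc j)"
    by (metis One_nat_def not0_implies_Suc)
  then show "i \<in> descents (x # w) \<longleftrightarrow>
    i \<in> (if x = H \<and> w \<noteq> [] \<and> hd w = V then {1} else {}) \<union> Suc ` descents w"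
    by cases (auto simp: descents_def hd_conv_nth image_iff)
qed

lemma one_notin_Suc_descents: "Suc 0 \<notin> Suc ` descents w"
  by (auto simp: descents_def)

lemma des_Cons: "des (x # w) = of_bool (x = H \<and> w \<noteq> [] \<and> hd w = V) + des w"
  by (auto simp: des_def descents_Cons card_image finite_descents one_notin_Suc_descents)

text \<open>A new first letter moves each of the \<open>des w\<close> descents one place to the
  right.\<close>

lemma MAJ_Cons: "MAJ (x # w) = of_bool (x = H \<and> w \<noteq> [] \<and> hd w = V) + MAJ w + des w"
proof -
  have "\<Sum>(Suc ` descents w) = MAJ w + des w"
    by (simp add: sum.reindex MAJ_def des_def sum_Suc)
  then show ?thesis
    by (auto simp: MAJ_def descents_Cons finite_descents one_notin_Suc_descents)
qed

lemma length_valleys: "length (valleys b a w) = des w"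
proof (induction w arbitrary: b a)
  case (Cons x w)
  then show ?case by (cases x) (auto simp: des_Cons)
qed (simp add: des_def descents_def)

text \<open>Each of the \<open>des w\<close> valleys has its position in \<open>w\<close> offset by
  the \<open>b + a\<close> letters passed earlier.\<close>

lemma sum_valleys: "(\<Sum>(b', a') \<leftarrow> valleys b a w. b' + a') = MAJ w + (b + a) * des w"
proof (induction w arbitrary: b a)
  case (Cons x w)
  then show ?case by (cases x) (auto simp: des_Cons MAJ_Cons algebra_simps)
qed (simp add: MAJ_def des_def descents_def)

section \<open>The bijection with two-column tableaux\<close>

definition two_column_tableau :: "letter list \<Rightarrow> nat list list" where
  "two_column_tableau w = map (\<lambda>(b, a). [b, a]) (valleys 0 0 w)"

lemma ssyt_two_columns_iff:
  "map (\<lambda>(b, a). [b, a]) T \<in> ssyt (replicate k 2) m \<longleftrightarrow>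
     length T = k \<and> sorted_wrt (\<lambda>p p'. fst p < fst p' \<and> snd p < snd p') T \<and>
     (\<forall>(b, a) \<in> set T. 1 \<le> b \<and> b \<le> a \<and> a \<le> m)"
proof -
  have shape: "map length (map (\<lambda>(b, a). [b, a]) T) = replicate k 2 \<longleftrightarrow> length T = k"
    by (auto simp: list_eq_iff_nth_eq split_beta)
  have rows: "(\<forall>r \<in> set (map (\<lambda>(b, a). [b, a]) T). sorted r \<and> set r \<subseteq> {1..m}) \<longleftrightarrow>
    (\<forall>(b, a) \<in> set T. 1 \<le> b \<and> b \<le> a \<and> a \<le> m)"
    by (fastforce simp: split_beta)
  have columns: "(\<forall>j < length [x', y']. [x, y] ! j < [x', y'] ! j) \<longleftrightarrow> x < x' \<and> y < y'"
    for x y x' y' :: nat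
    by (auto simp: All_less_Suc)
  \<comment> \<open>\<open>ssyt\<close> compares adjacent rows only, \<open>sorted_wrt\<close> all
    pairs; transitivity bridges the two.\<close>
  have "transp (\<lambda>p p' :: nat \<times> nat. fst p < fst p' \<and> snd p < snd p')"
    by (auto intro: transpI)
  then have "(\<forall>i j. Suc i < length (map (\<lambda>(b, a). [b, a]) T) \<and>
      j < length (map (\<lambda>(b, a). [b, a]) T ! Suc i) \<longrightarrow>
      map (\<lambda>(b, a). [b, a]) T ! i ! j < map (\<lambda>(b, a). [b, a]) T ! Suc i ! j) \<longleftrightarrow>
    sorted_wrt (\<lambda>p p'. fst p < fst p' \<and> snd p < snd p') T"
    using columns
    by (simp add: sorted_wrt_iff_nth_Suc_transp split_beta imp_conjL del: length_Cons list.size)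
  with shape rows show ?thesis
    unfolding ssyt_def mem_Collect_eq by blast
qed

lemma bij_betw_two_column_tableau:
  "bij_betw two_column_tableau {w \<in> dyck_paths n. des w = k} (ssyt (replicate k 2) (n - 1))"
proof (rule bij_betwI')
  fix w w'
  assume "w \<in> {w \<in> dyck_paths n. des w = k}" "w' \<in> {w \<in> dyck_paths n. des w = k}"
  then have "valley_path n n 0 0 (valleys 0 0 w) = w" "valley_path n n 0 0 (valleys 0 0 w') = w'"
    by (auto intro!: valley_path_valleys simp: dyck_paths_def)
  moreover have "inj (\<lambda>(b, a). [b, a])"
    by (auto intro: injI)
  ultimately show "two_column_tableau w = two_column_tableau w' \<longleftrightarrow> w = w'"
    unfolding two_column_tableau_def by (metis inj_map_eq_map)
next
  fix w
  assume w: "w \<in> {w \<in> dyck_paths n. des w = k}"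
  then have "\<forall>(b, a) \<in> set (valleys 0 0 w). b \<le> a"
    using above_diagonal_iff_valleys[of 0 w 0] by (simp add: dyck_paths_def)
  \<comment> \<open>The bound \<open>n - 1\<close> arises because a \<open>V\<close> still follows
    each valley.\<close>
  then have "\<forall>(b, a) \<in> set (valleys 0 0 w). 1 \<le> b \<and> b \<le> a \<and> a \<le> n - 1"
    using set_valleys[of _ _ 0 0 w] w by (fastforce simp: dyck_paths_def)
  then show "two_column_tableau w \<in> ssyt (replicate k 2) (n - 1)"
    unfolding two_column_tableau_def ssyt_two_columns_iff
    using w by (simp add: length_valleys sorted_valleys)
next
  fix S
  assume S: "S \<in> ssyt (replicate k 2) (n - 1)"
  define T where "T = map (\<lambda>r. (r ! 0, r ! 1)) S"
  have "length r = 2" if "r \<in> set S" for r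
  proof -
    have "length r \<in> set (map length S)" using that by simp
    also have "map length S = replicate k 2" using S by (simp add: ssyt_def)
    finally show ?thesis by (simp split: if_splits)
  qed
  then have "[r ! 0, r ! 1] = r" if "r \<in> set S" for r
    using that by (auto simp: list_eq_iff_nth_eq less_Suc_eq numeral_2_eq_2)
  then have S_eq: "S = map (\<lambda>(b, a). [b, a]) T"
    by (simp add: T_def o_def map_idI)
  have len: "length T = k"
    and sorted: "sorted_wrt (\<lambda>p p'. fst p < fst p' \<and> snd p < snd p') T"
    and T: "\<And>b a. (b, a) \<in> set T \<Longrightarrow> 1 \<le> b \<and> b \<le> a \<and> a \<le> n - 1"
    using S unfolding S_eq ssyt_two_columns_iff by auto
  define w where "w = valley_path n n 0 0 T"
  \<comment> \<open>Any row satisfies \<open>1 \<le> a \<le> n - 1\<close>, which excludes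
    \<open>n = 0\<close> and so yields \<open>a < n\<close>.\<close>
  have bounds: "0 < b \<and> b \<le> n \<and> 0 \<le> a \<and> a < n" if "(b, a) \<in> set T" for b a
    using T[OF that] by auto
  have valleys_w: "valleys 0 0 w = T"
    unfolding w_def using sorted bounds by (auto intro!: valleys_valley_path)
  have count: "count_list w H = n" "count_list w V = n"
    using count_valley_path[OF sorted, of 0 n 0 n] bounds unfolding w_def
    by (auto intro: less_imp_le)
  have "length w = count_list w H + count_list w V" for w
  proof (induction w)
    case (Cons x w)
    then show ?case by (cases x) auto
  qed simp
  then have "length w = 2 * n"
    using count by simp
  moreover have "\<forall>i \<le> length w. count_list (take i w) H \<le> count_list (take i w) V"
    using above_diagonal_iff_valleys[of 0 w 0] T by (auto simp: count valleys_w)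
  ultimately have "w \<in> dyck_paths n"
    by (simp add: dyck_paths_def count)
  moreover have "des w = k"
    using length_valleys[of 0 0 w] by (simp add: valleys_w len)
  ultimately show "\<exists>w \<in> {w \<in> dyck_paths n. des w = k}. S = two_column_tableau w"
    by (auto simp: two_column_tableau_def valleys_w S_eq)
qed

lemma sum_list_two_column_tableau: "sum_list (concat (two_column_tableau w)) = MAJ w"
proof -
  have "sum_list (concat (map (\<lambda>(b, a). [b, a]) T)) = (\<Sum>(b, a) \<leftarrow> T. b + a)"
    for T :: "(nat \<times> nat) list"
    by (induction T) auto
  then show ?thesis
    by (simp add: two_column_tableau_def sum_valleys)
qed

section \<open>Specialization of the Schur function\<close>

lemma principal_specialization_weight:
  fixes q :: "'a::comm_semiring_1"
  assumes "T \<in> ssyt lam (n - 1)"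
  shows "(\<Prod>i = 1..n - 1. (map (\<lambda>i. q ^ i) [1..<n] ! (i - 1)) ^ count_list (concat T) i) =
    q ^ sum_list (concat T)"
proof -
  have "(\<Prod>i = 1..n - 1. (map (\<lambda>i. q ^ i) [1..<n] ! (i - 1)) ^ count_list (concat T) i) =
    (\<Prod>i = 1..n - 1. q ^ (count_list (concat T) i * i))"
    \<comment> \<open>The list starts with \<open>q ^ 1\<close>, so its element at index
      \<open>i - 1\<close> is \<open>q ^ i\<close>.\<close>
    by (intro prod.cong) (auto simp: power_mult[symmetric] mult.commute)
  also have "\<dots> = q ^ (\<Sum>i = 1..n - 1. count_list (concat T) i * i)"
    by (simp add: power_sum)
  also have "set (concat T) \<subseteq> {1..n - 1}"
    using assms by (auto simp: ssyt_def)
  then have "(\<Sum>i = 1..n - 1. count_list (concat T) i * i) = sum_list (concat T)"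
    using sum_list_map_eq_sum_count2[of "concat T" "{1..n - 1}" "\<lambda>i. i"] by simp
  finally show ?thesis .
qed

theorem theorem2p5:
  fixes q :: "'a::comm_semiring_1" and n k :: nat
  shows "q_narayana q n k = schur_function (replicate k 2) (map (\<lambda>i. q ^ i) [1..<n])"
proof -
  have "q_narayana q n k =
    (\<Sum>w \<in> {w \<in> dyck_paths n. des w = k}. q ^ sum_list (concat (two_column_tableau w)))"
    by (simp add: q_narayana_def sum_list_two_column_tableau)
  also have "\<dots> = (\<Sum>T \<in> ssyt (replicate k 2) (n - 1). q ^ sum_list (concat T))"
    using sum.reindex_bij_betw[OF bij_betw_two_column_tableau] .
  \<comment> \<open>There are \<open>n - 1\<close> variables, also for \<open>n = 0\<close>, where
    \<open>[1..<n]\<close> is empty.\<close>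
  also have "\<dots> = schur_function (replicate k 2) (map (\<lambda>i. q ^ i) [1..<n])"
    unfolding schur_function_def
    by (intro sum.cong) (simp_all add: principal_specialization_weight[symmetric])
  finally show ?thesis .
qed

end
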